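(* Let $p$ be a prime and let $G$ be a finite $p$-group with a regular power structure. Then $G$ satisfies the Hughes conjecture, i.e. if $H_{p}(G) \neq 1$ then either $H_{p}(G) = G$ or $|G : H_{p}(G)| = p$. In particular, if $G$ has exponent $p$ then $H_{p}(G) = 1$, and otherwise $H_{p}(G) = G$.
   Context: For a group $G$ and a prime $p$, $H_{p}(G)$ denotes the subgroup of $G$ generated by all elements of $G$ that do not have order $p$. For a finite $p$-group $G$ and a positive integer $i$, let $G^{p^{i}} = \langle g^{p^{i}} \mid g \in G\rangle$ and $\Omega_{i}(G) = \langle g \in G \mid o(g) \leq p^{i}\rangle$, where $o(g)$ is the order of $g$. A finite $p$-group $G$ has a regular power structure if for all positive integers $i$ the following three conditions hold: (1) $G^{p^{i}} = \{g^{p^{i}} \mid g \in G\}$; (2) $\Omega_{i}(G) = \{g \in G \mid o(g) \leq p^{i}\}$; (3) $|G : G^{p^{i}}| = |\Omega_{i}(G)|$. *)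

theory Defs
  imports "HOL-Algebra.Multiplicative_Group" "HOL-Algebra.Generated_Groups"
    "HOL-Computational_Algebra.Primes"
begin

(* The trivial group (n = 0) counts as a finite p-group. *)
definition finite_p_group :: "nat \<Rightarrow> ('a, 'b) monoid_scheme \<Rightarrow> bool" where
  "finite_p_group p G \<longleftrightarrow>
     group G \<and> finite (carrier G) \<and> (\<exists>n::nat. order G = p ^ n)"

definition subgroup_index :: "('a, 'b) monoid_scheme \<Rightarrow> 'a set \<Rightarrow> nat" where
  "subgroup_index G H = card (rcosets\<^bsub>G\<^esub> H)"

(* Meaningful only if some positive power annihilates G, in particular for every finite G. *)
definition group_exponent :: "('a, 'b) monoid_scheme \<Rightarrow> nat" where
  "group_exponent G =
     (LEAST n::nat. 0 < n \<and> (\<forall>g\<in>carrier G. g [^]\<^bsub>G\<^esub> n = \<one>\<^bsub>G\<^esub>))"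

definition hughes_subgroup :: "nat \<Rightarrow> ('a, 'b) monoid_scheme \<Rightarrow> 'a set" where
  "hughes_subgroup p G = generate G {g \<in> carrier G. group.ord G g \<noteq> p}"

definition agemo :: "nat \<Rightarrow> nat \<Rightarrow> ('a, 'b) monoid_scheme \<Rightarrow> 'a set" where
  "agemo p i G = generate G {g [^]\<^bsub>G\<^esub> (p ^ i) | g. g \<in> carrier G}"

definition omega :: "nat \<Rightarrow> nat \<Rightarrow> ('a, 'b) monoid_scheme \<Rightarrow> 'a set" where
  "omega p i G = generate G {g \<in> carrier G. group.ord G g \<le> p ^ i}"

definition regular_power_structure :: "nat \<Rightarrow> ('a, 'b) monoid_scheme \<Rightarrow> bool" where
  "regular_power_structure p G \<longleftrightarrow>
     (\<forall>i::nat. 0 < i \<longrightarrow>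
        agemo p i G = {g [^]\<^bsub>G\<^esub> (p ^ i) | g. g \<in> carrier G} \<and>
        omega p i G = {g \<in> carrier G. group.ord G g \<le> p ^ i} \<and>
        subgroup_index G (agemo p i G) = card (omega p i G))"

end

theory Submission
  imports Defs
begin

text \<open>
  A regular power structure makes the elements of order at most p a subgroup, namely
  \<open>omega p 1 G\<close>. If G has an element x of larger order, this subgroup is
  proper, and every element outside it belongs to the generating set of the Hughes subgroup.
  A group is generated by the complement of any proper subgroup
  (\<open>generate_complement_of_proper_subgroup\<close>), so the Hughes subgroup is G.

  If no element has order greater than p, then, as all orders are powers of p, each is 1 or p.
  Either an element of order p exists, so that the exponent is p and the Hughes subgroup is
  generated by the identity alone, or G is trivial and equals its Hughes subgroup.
  The Hughes subgroup is thus always 1 or G, which settles the Hughes conjecture for G.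
\<close>

text \<open>Fix x outside H. For h in H the product x h is again outside H, and h is the quotient of
  x h by x.\<close>
lemma (in group) generate_complement_of_proper_subgroup:
  assumes H: "subgroup H G" and proper: "H \<noteq> carrier G"
  shows "generate G (carrier G - H) = carrier G"
proof
  show "generate G (carrier G - H) \<subseteq> carrier G"
    by (rule generate_incl) auto
next
  obtain x where x: "x \<in> carrier G" "x \<notin> H"
    using proper subgroup.subset[OF H] by blast
  show "carrier G \<subseteq> generate G (carrier G - H)"
  proof
    fix g assume g: "g \<in> carrier G"
    show "g \<in> generate G (carrier G - H)"
    proof (cases "g \<in> H")
      case False
      with g show ?thesis by (intro generate.incl) auto
    next
      case True
      have "x \<otimes> g \<notin> H"
      proof
        assume "x \<otimes> g \<in> H"
        then have "(x \<otimes> g) \<otimes> inv g \<in> H"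
          using True H by (simp add: subgroup.m_closed subgroup.m_inv_closed)
        with x g show False by (simp add: m_assoc)
      qed
      then have "inv x \<otimes> (x \<otimes> g) \<in> generate G (carrier G - H)"
        using x g by (intro generate.eng generate.inv generate.incl) auto
      moreover have "inv x \<otimes> (x \<otimes> g) = g"
        using x g by (simp add: m_assoc[symmetric])
      ultimately show ?thesis by simp
    qed
  qed
qed

text \<open>The exponent is a least number, so finiteness is needed to know that some positive power
  annihilates the group at all.\<close>
lemma (in group) pow_group_exponent_eq_one:
  assumes "finite (carrier G)" "g \<in> carrier G"
  shows "g [^] group_exponent G = \<one>"
proof -
  have "0 < order G \<and> (\<forall>h\<in>carrier G. h [^] order G = \<one>)"
    using assms(1) by (simp add: order_gt_0_iff_finite pow_order_eq_1)
  then have "0 < group_exponent G \<and> (\<forall>h\<in>carrier G. h [^] group_exponent G = \<one>)"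
    unfolding group_exponent_def by (rule LeastI)
  with assms(2) show ?thesis by blast
qed

lemma (in group) group_exponent_eqI:
  assumes pos: "0 < n"
    and annihilates: "\<And>g. g \<in> carrier G \<Longrightarrow> g [^] n = \<one>"
    and x: "x \<in> carrier G" "ord x = n"
  shows "group_exponent G = n"
  unfolding group_exponent_def
proof (rule Least_equality)
  show "0 < n \<and> (\<forall>g\<in>carrier G. g [^] n = \<one>)"
    using pos annihilates by blast
next
  fix m :: nat
  assume m: "0 < m \<and> (\<forall>g\<in>carrier G. g [^] m = \<one>)"
  with x have "n dvd m"
    by (metis pow_eq_id)
  with m show "n \<le> m"
    by (simp add: dvd_imp_le)
qed

text \<open>The order of g is a power of p by Lagrange, and the only such powers up to p are 1 and p.\<close>
lemma (in group) ord_le_prime_imp_pow_eq_one: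
  assumes p: "prime p" and G: "finite_p_group p G"
    and g: "g \<in> carrier G" "ord g \<le> p"
  shows "g [^] p = \<one>"
proof -
  obtain n where "order G = p ^ n"
    using G by (auto simp: finite_p_group_def)
  moreover have "ord g dvd order G"
    using g(1) by (rule ord_dvd_group_order)
  ultimately obtain k where k: "ord g = p ^ k"
    using p by (auto simp: divides_primepow_nat)
  have "k \<le> 1"
    using g(2) k p prime_gt_1_nat power_increasing_iff[of p k 1] by simp
  then have "ord g dvd p"
    using k le_imp_power_dvd[of k 1 p] by simp
  then show ?thesis
    using g(1) by (simp add: pow_eq_id)
qed

lemma (in group) hughes_subgroup_trivial_if_exponent_prime:
  assumes p: "prime p" and fin: "finite (carrier G)" and exponent: "group_exponent G = p"
  shows "hughes_subgroup p G = {\<one>}"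
proof -
  have "g = \<one>" if g: "g \<in> carrier G" and "ord g \<noteq> p" for g
  proof -
    have "ord g dvd p"
      using pow_group_exponent_eq_one[OF fin g] g exponent by (simp add: pow_eq_id)
    with p \<open>ord g \<noteq> p\<close> have "ord g = 1"
      by (auto simp: prime_nat_iff)
    with g show ?thesis using ord_eq_1 by blast
  qed
  then have "{g \<in> carrier G. ord g \<noteq> p} \<subseteq> {\<one>}"
    by blast
  then have "hughes_subgroup p G \<subseteq> generate G {\<one>}"
    unfolding hughes_subgroup_def by (rule mono_generate)
  moreover have "\<one> \<in> hughes_subgroup p G"
    unfolding hughes_subgroup_def by (rule generate.one)
  ultimately show ?thesis
    by (auto simp: generate_one)
qed

lemma (in group) hughes_subgroup_eq_carrier_if_exponent_not_prime:
  assumes p: "prime p" and G: "finite_p_group p G" and rps: "regular_power_structure p G"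
    and exponent: "group_exponent G \<noteq> p"
  shows "hughes_subgroup p G = carrier G"
proof -
  define S where "S = {g \<in> carrier G. ord g \<le> p}"
  have "omega p 1 G = S"
    using rps unfolding regular_power_structure_def S_def by fastforce
  then have subgroup_S: "subgroup S G"
    by (metis (no_types, lifting) omega_def generate_is_subgroup mem_Collect_eq subsetI)
  have hughes_incl: "hughes_subgroup p G \<subseteq> carrier G"
    unfolding hughes_subgroup_def by (rule generate_incl) auto
  show ?thesis
  proof (cases "S = carrier G")
    case False
    have "carrier G - S \<subseteq> {g \<in> carrier G. ord g \<noteq> p}"
      by (auto simp: S_def)
    then have "generate G (carrier G - S) \<subseteq> hughes_subgroup p G"
      unfolding hughes_subgroup_def by (rule mono_generate)
    with generate_complement_of_proper_subgroup[OF subgroup_S False] hughes_incl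
    show ?thesis by simp
  next
    case True
    then have "g [^] p = \<one>" if "g \<in> carrier G" for g
      using that ord_le_prime_imp_pow_eq_one[OF p G] by (auto simp: S_def)
    (* An element of order p would force the exponent to be p. *)
    then have "ord g \<noteq> p" if "g \<in> carrier G" for g
      using that exponent group_exponent_eqI[of p g] prime_gt_0_nat[OF p] by blast
    then have "carrier G \<subseteq> hughes_subgroup p G"
      unfolding hughes_subgroup_def by (auto intro: generate.incl)
    with hughes_incl show ?thesis by blast
  qed
qed

theorem theorem2:
  fixes p :: nat and G :: "('a, 'b) monoid_scheme"
  assumes "prime p"
    and "finite_p_group p G"
    and "regular_power_structure p G"
  shows "(hughes_subgroup p G \<noteq> {\<one>\<^bsub>G\<^esub>} \<longrightarrow>
            hughes_subgroup p G = carrier G \<or> subgroup_index G (hughes_subgroup p G) = p)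
       \<and> (group_exponent G = p \<longrightarrow> hughes_subgroup p G = {\<one>\<^bsub>G\<^esub>})
       \<and> (group_exponent G \<noteq> p \<longrightarrow> hughes_subgroup p G = carrier G)"
proof -
  interpret group G
    using assms(2) by (simp add: finite_p_group_def)
  have "finite (carrier G)"
    using assms(2) by (simp add: finite_p_group_def)
  then show ?thesis
    using hughes_subgroup_trivial_if_exponent_prime[OF assms(1)]
      hughes_subgroup_eq_carrier_if_exponent_not_prime[OF assms]
    by blast
qed

end
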